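(* Let $N$ be a polygonal norm in the plane $\mathbb{R}^2$, and let $\lambda$ be the smallest $N$-distance between two consecutive vertices of its unit disc. Then for each positive $q < \lambda/(1+\lambda)$, we have $\chi\big(\mathbb{R}^2, N, \mathcal{G}(q)\big) \ge 3$. In other words, for every two-colouring of the plane, there exists a monochromatic $N$-isometric copy of $\mathcal{G}(q)$.
   Context: A norm $N$ on $\mathbb{R}^2$ is denoted $\|\cdot\|_N$; the $N$-distance between $\mathbf{x}, \mathbf{y}$ is $\|\mathbf{x}-\mathbf{y}\|_N$. The norm $N$ is polygonal if its unit disc $\{\mathbf{x} \in \mathbb{R}^2 : \|\mathbf{x}\|_N \le 1\}$ is a (convex) polygon. For $q>0$, $\mathcal{G}(q) = \{0,\, 1,\, 1+q,\, 1+q+q^2,\, \dots\} \subset \mathbb{R}$ is the infinite geometric progression, regarded as a metric space with distance $|x-y|$. A set $\mathcal{M}' \subset \mathbb{R}^2$ is an $N$-isometric copy of $\mathcal{G}(q)$ if there exists a bijection $f : \mathcal{G}(q) \to \mathcal{M}'$ such that $\|f(x)-f(y)\|_N = |x-y|$ for all $x, y \in \mathcal{G}(q)$ (copies need not be collinear). The chromatic number $\chi(\mathbb{R}^2, N, \mathcal{G}(q))$ is the minimum number of colours needed to colour all points of $\mathbb{R}^2$ such that no $N$-isometric copy of $\mathcal{G}(q)$ is monochromatic. *)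

theory Defs
  imports "HOL-Analysis.Analysis" "HOL-Library.Extended_Nat"
begin

definition is_norm :: "(real^2 \<Rightarrow> real) \<Rightarrow> bool" where
  "is_norm N \<longleftrightarrow>
     (\<forall>x. 0 \<le> N x) \<and>
     (\<forall>x. N x = 0 \<longleftrightarrow> x = 0) \<and>
     (\<forall>a x. N (a *\<^sub>R x) = \<bar>a\<bar> * N x) \<and>
     (\<forall>x y. N (x + y) \<le> N x + N y)"

definition unit_disc :: "(real^2 \<Rightarrow> real) \<Rightarrow> (real^2) set" where
  "unit_disc N = {x. N x \<le> 1}"

(* The unit disc of a norm on the plane has nonempty interior, so being a polytope
   (the convex hull of a finite set) means being a nondegenerate convex polygon. *)
definition polygonal_norm :: "(real^2 \<Rightarrow> real) \<Rightarrow> bool" where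
  "polygonal_norm N \<longleftrightarrow> is_norm N \<and> polytope (unit_disc N)"

(* Two distinct vertices of a convex polygon are consecutive when the segment
   joining them is one of its sides. *)
definition consecutive_vertices :: "(real^2) set \<Rightarrow> real^2 \<Rightarrow> real^2 \<Rightarrow> bool" where
  "consecutive_vertices P v w \<longleftrightarrow>
     v extreme_point_of P \<and> w extreme_point_of P \<and> v \<noteq> w \<and>
     closed_segment v w edge_of P"

(* For a polygonal norm the set below is finite and nonempty, so the minimum is attained. *)
definition min_side_length :: "(real^2 \<Rightarrow> real) \<Rightarrow> real" where
  "min_side_length N = Min {N (v - w) |v w. consecutive_vertices (unit_disc N) v w}"

definition geometric_progression :: "real \<Rightarrow> real set" where
  "geometric_progression q = range (\<lambda>n::nat. \<Sum>i<n. q ^ i)"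

definition isometric_copy ::
    "(real^2 \<Rightarrow> real) \<Rightarrow> 'a::metric_space set \<Rightarrow> (real^2) set \<Rightarrow> bool" where
  "isometric_copy N M M' \<longleftrightarrow>
     (\<exists>f. bij_betw f M M' \<and> (\<forall>x\<in>M. \<forall>y\<in>M. N (f x - f y) = dist x y))"

definition has_monochromatic_copy ::
    "(real^2 \<Rightarrow> real) \<Rightarrow> 'a::metric_space set \<Rightarrow> (real^2 \<Rightarrow> 'c) \<Rightarrow> bool" where
  "has_monochromatic_copy N M c \<longleftrightarrow> (\<exists>M'. isometric_copy N M M' \<and> c constant_on M')"

(* The value is infinity if no finite number of colours suffices. *)
definition chromatic_number :: "(real^2 \<Rightarrow> real) \<Rightarrow> 'a::metric_space set \<Rightarrow> enat" where
  "chromatic_number N M =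
     Inf {enat k |k. \<exists>c :: real^2 \<Rightarrow> nat. range c \<subseteq> {..<k} \<and> \<not> has_monochromatic_copy N M c}"

end

theory Submission
  imports Defs
begin

text \<open>A sequence whose \<open>n\<close>-th step lies in \<open>q\<^sup>n\<close> times a fixed side of the unit disc is an isometric
  copy of the progression, because the norm is linear on the cone over that side. Suppose a
  two-colouring has no monochromatic copy. Building such a sequence greedily from any point must fail,
  which produces a monochromatic translate of \<open>q\<^sup>k\<close> times a side; take \<open>k\<close> minimal. As the sides
  are longer than \<open>q / (1 - q)\<close>, this segment contains the straight tail of the progression starting
  at scale \<open>q\<^bsup>k+1\<^esup>\<close>, with room to slide. By minimality of \<open>k\<close> the possible predecessors of
  such tails all have the other colour, and they form a larger zonotope containing a translate of
  \<open>q\<^sup>k\<close> times the next side. Iterating, some direction occurs infinitely often, so monochromatic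
  segments become arbitrarily long and finally contain a copy of the whole progression.\<close>

section \<open>Norms, geometric sums, and copies given by sequences\<close>

lemma is_normD:
  assumes "is_norm N"
  shows "0 \<le> N x" "N x = 0 \<longleftrightarrow> x = 0" "N (a *\<^sub>R x) = \<bar>a\<bar> * N x" "N (x + y) \<le> N x + N y"
  using assms by (auto simp: is_norm_def)

lemma is_norm_minus_commute:
  assumes "is_norm N"
  shows "N (x - y) = N (y - x)"
  using is_normD(3)[OF assms, of "-1" "x - y"] by simp

lemma geometric_sum_tail:
  fixes q :: real
  assumes "0 < q" "q < 1" "m \<le> n"
  shows "(\<Sum>i=m..<n. q ^ i) = (q ^ m - q ^ n) / (1 - q)"
    and "(\<Sum>i=m..<n. q ^ i) \<le> q ^ m / (1 - q)"
proof -
  show *: "(\<Sum>i=m..<n. q ^ i) = (q ^ m - q ^ n) / (1 - q)"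
    using \<open>m \<le> n\<close>
  proof (induction n rule: dec_induct)
    case (step n)
    have "(\<Sum>i=m..<Suc n. q ^ i) = (q ^ m - q ^ n) / (1 - q) + q ^ n"
      using step by simp
    also have "\<dots> = (q ^ m - q ^ Suc n) / (1 - q)"
      using assms by (simp add: field_simps)
    finally show ?case .
  qed simp
  show "(\<Sum>i=m..<n. q ^ i) \<le> q ^ m / (1 - q)"
    unfolding * using assms by (simp add: divide_right_mono)
qed

lemma bij_betw_geometric_progression:
  fixes q :: real
  assumes "0 < q"
  shows "bij_betw (\<lambda>n::nat. \<Sum>i<n. q ^ i) UNIV (geometric_progression q)"
proof -
  have "strict_mono (\<lambda>n::nat. \<Sum>i<n. q ^ i)"
    using assms by (simp add: strict_mono_Suc_iff)
  then show ?thesis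
    unfolding geometric_progression_def
    by (simp add: strict_mono_on_imp_inj_on inj_on_imp_bij_betw)
qed

text \<open>The partial sums index the progression by the naturals. Composing \<open>f\<close> with
  the inverse \<open>g\<close> of this indexing gives the isometry, and preservation of distances
  makes it injective.\<close>

lemma isometric_copy_range:
  fixes f :: "nat \<Rightarrow> real^2"
  assumes N: "is_norm N" and q: "0 < q"
    and f: "\<And>m n. m \<le> n \<Longrightarrow> N (f n - f m) = (\<Sum>i=m..<n. q ^ i)"
  shows "isometric_copy N (geometric_progression q) (range f)"
proof -
  let ?x = "\<lambda>n::nat. \<Sum>i<n. q ^ i"
  define g where "g = the_inv_into UNIV ?x"
  have bij: "bij_betw ?x UNIV (geometric_progression q)"
    by (rule bij_betw_geometric_progression[OF q])
  have xle: "?x n - ?x m = (\<Sum>i=m..<n. q ^ i)" if "m \<le> n" for m n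
    using that by (simp add: lessThan_atLeast0 sum_diff_nat_ivl)
  have dist: "N (f m - f n) = dist (?x m) (?x n)" for m n
  proof (induction m n rule: linorder_wlog)
    case (le m n)
    have "0 \<le> (\<Sum>i=m..<n. q ^ i)"
      using q by (simp add: sum_nonneg)
    then show ?case
      using f[OF le] xle[OF le] is_norm_minus_commute[OF N] by (metis abs_of_nonneg dist_commute dist_real_def)
  qed (metis dist_commute is_norm_minus_commute[OF N])
  have "inj f"
  proof (rule injI)
    fix m n assume "f m = f n"
    then have "?x m = ?x n"
      using dist[of m n] is_normD(2)[OF N, of 0] by simp
    then show "m = n"
      using bij unfolding bij_betw_def inj_def by blast
  qed
  have g: "bij_betw g (geometric_progression q) UNIV"
    unfolding g_def by (rule bij_betw_the_inv_into[OF bij])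
  have gx: "?x (g y) = y" if "y \<in> geometric_progression q" for y
    unfolding g_def using f_the_inv_into_f_bij_betw[OF bij] that by blast
  have "bij_betw (f \<circ> g) (geometric_progression q) (range f)"
    using g \<open>inj f\<close> by (auto intro!: bij_betw_trans inj_on_imp_bij_betw)
  moreover have "N ((f \<circ> g) x - (f \<circ> g) y) = dist x y"
    if "x \<in> geometric_progression q" "y \<in> geometric_progression q" for x y
    using dist[of "g x" "g y"] gx that by simp
  ultimately show ?thesis
    unfolding isometric_copy_def by blast
qed

section \<open>Chains of steps along the sides of the unit disc\<close>

text \<open>Collects what the colouring argument uses about the unit disc. \<open>E\<close> holds
  its sides as ordered pairs of end points, and \<open>long_sides\<close> is the bound
  \<open>q < l / (1 + l)\<close> solved for the side length.\<close>

locale side_system =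
  fixes N :: "real^2 \<Rightarrow> real" and q :: real and E :: "((real^2) \<times> (real^2)) set"
  assumes norm: "is_norm N"
    and q: "0 < q" "q < 1"
    and finite_sides: "finite E"
    and norm_cone: "\<And>v w a b. \<lbrakk>(v, w) \<in> E; 0 \<le> a; 0 \<le> b\<rbrakk> \<Longrightarrow> N (a *\<^sub>R v + b *\<^sub>R w) = a + b"
    and long_sides: "\<And>v w. (v, w) \<in> E \<Longrightarrow> q / (1 - q) < N (w - v)"
    and cones_cover: "\<And>x. x \<noteq> 0 \<Longrightarrow>
      \<exists>v w a b. (v, w) \<in> E \<and> 0 \<le> a \<and> 0 \<le> b \<and> x = a *\<^sub>R v + b *\<^sub>R w"
begin

lemma unit_in_side:
  assumes "N x = 1"
  obtains s where "s \<in> E" "x \<in> closed_segment (fst s) (snd s)"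
proof -
  have "x \<noteq> 0"
    using assms is_normD(2)[OF norm, of x] by auto
  from cones_cover[OF this] obtain v w a b
    where *: "(v, w) \<in> E" "0 \<le> a" "0 \<le> b" "x = a *\<^sub>R v + b *\<^sub>R w"
    by (elim exE conjE)
  then have "a + b = 1"
    using norm_cone[OF *(1-3)] assms by simp
  then have "a = 1 - b"
    by simp
  then have "x = (1 - b) *\<^sub>R v + b *\<^sub>R w" "b \<le> 1"
    using *(2,4) by simp_all
  then have "x \<in> closed_segment v w"
    using *(3) by (auto simp: in_segment)
  then show thesis
    using that[of "(v, w)"] *(1) by simp
qed

definition dir :: "(real^2) \<times> (real^2) \<Rightarrow> real^2"
  where "dir s = snd s - fst s"

definition unit_dir :: "(real^2) \<times> (real^2) \<Rightarrow> real^2"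
  where "unit_dir s = dir s /\<^sub>R N (dir s)"

text \<open>\<open>unit_dir s\<close> has norm 1, so it lies on some side; one such side is fixed.
  Straight steps parallel to \<open>s\<close> are thereby steps of a chain over
  \<open>next_side s\<close>, which is how the argument passes from one direction to the
  next.\<close>

definition next_side :: "(real^2) \<times> (real^2) \<Rightarrow> (real^2) \<times> (real^2)"
  where "next_side s = (SOME s'. s' \<in> E \<and> unit_dir s \<in> closed_segment (fst s') (snd s'))"

lemma dir_long: "s \<in> E \<Longrightarrow> q / (1 - q) < N (dir s)"
  using long_sides[of "fst s" "snd s"] by (simp add: dir_def)

lemma dir_pos: "s \<in> E \<Longrightarrow> 0 < N (dir s)"
  using dir_long[of s] q by (smt (verit) divide_nonneg_nonneg)

lemma next_side:
  assumes "s \<in> E"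
  shows "next_side s \<in> E" "unit_dir s \<in> closed_segment (fst (next_side s)) (snd (next_side s))"
proof -
  have "N (unit_dir s) = 1"
    using dir_pos[OF assms] by (simp add: unit_dir_def is_normD(3)[OF norm])
  then obtain s' where "s' \<in> E \<and> unit_dir s \<in> closed_segment (fst s') (snd s')"
    using unit_in_side by blast
  then have "next_side s \<in> E \<and> unit_dir s \<in> closed_segment (fst (next_side s)) (snd (next_side s))"
    unfolding next_side_def by (rule someI)
  then show "next_side s \<in> E" "unit_dir s \<in> closed_segment (fst (next_side s)) (snd (next_side s))"
    by auto
qed

text \<open>The tail of a copy that starts at scale \<open>q ^ j\<close>. Values of \<open>f\<close>
  below \<open>j\<close> are arbitrary, so a chain can be prolonged backwards by overwriting one of
  them.\<close>

definition side_chain :: "(real^2) \<times> (real^2) \<Rightarrow> nat \<Rightarrow> (nat \<Rightarrow> real^2) \<Rightarrow> bool"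
  where "side_chain s j f \<longleftrightarrow>
    (\<forall>n\<ge>j. \<exists>u\<in>closed_segment (fst s) (snd s). f (Suc n) = f n + q ^ n *\<^sub>R u)"

text \<open>Each difference \<open>f n - f m\<close> is a nonnegative combination of the ends of the
  side whose coefficients add up to the geometric sum, and \<open>norm_cone\<close> evaluates its
  norm.\<close>

lemma isometric_copy_side_chain:
  assumes s: "s \<in> E" and f: "side_chain s 0 f"
  shows "isometric_copy N (geometric_progression q) (range f)"
proof (rule isometric_copy_range[OF norm q(1)])
  fix m n :: nat assume "m \<le> n"
  then have "\<exists>a b. 0 \<le> a \<and> 0 \<le> b \<and> a + b = (\<Sum>i=m..<n. q ^ i) \<and>
    f n - f m = a *\<^sub>R fst s + b *\<^sub>R snd s"
  proof (induction n rule: dec_induct)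
    case (step n)
    then obtain a b where ab: "0 \<le> a" "0 \<le> b" "a + b = (\<Sum>i=m..<n. q ^ i)"
      "f n - f m = a *\<^sub>R fst s + b *\<^sub>R snd s"
      by blast
    obtain t where t: "0 \<le> t" "t \<le> 1"
      "f (Suc n) = f n + q ^ n *\<^sub>R ((1 - t) *\<^sub>R fst s + t *\<^sub>R snd s)"
      using f by (force simp: side_chain_def in_segment)
    show ?case
    proof (intro exI conjI)
      show "0 \<le> a + q ^ n * (1 - t)" "0 \<le> b + q ^ n * t"
        using ab t q by simp_all
      show "a + q ^ n * (1 - t) + (b + q ^ n * t) = (\<Sum>i=m..<Suc n. q ^ i)"
        using ab step.hyps by (simp add: algebra_simps)
      have "f n = f m + (a *\<^sub>R fst s + b *\<^sub>R snd s)"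
        using ab(4) by (simp add: algebra_simps)
      then show "f (Suc n) - f m = (a + q ^ n * (1 - t)) *\<^sub>R fst s + (b + q ^ n * t) *\<^sub>R snd s"
        by (simp add: t(3) algebra_simps)
    qed
  qed auto
  then show "N (f n - f m) = (\<Sum>i=m..<n. q ^ i)"
    using norm_cone[of "fst s" "snd s"] s by auto
qed

lemma side_chain_straight:
  assumes "s \<in> E"
  shows "side_chain (next_side s) j (\<lambda>n. y + (\<Sum>i=j..<n. q ^ i) *\<^sub>R unit_dir s)"
  unfolding side_chain_def
proof (intro allI impI bexI)
  fix n assume "j \<le> n"
  then show "y + (\<Sum>i=j..<Suc n. q ^ i) *\<^sub>R unit_dir s =
      y + (\<Sum>i=j..<n. q ^ i) *\<^sub>R unit_dir s + q ^ n *\<^sub>R unit_dir s"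
    by (simp add: algebra_simps)
qed (rule next_side(2)[OF assms])

end

section \<open>Two-colourings without a monochromatic copy\<close>

locale bad_colouring = side_system +
  fixes c :: "real^2 \<Rightarrow> bool"
  assumes no_copy: "\<not> has_monochromatic_copy N (geometric_progression q) c"
begin

definition mono_chain :: "(real^2) \<times> (real^2) \<Rightarrow> nat \<Rightarrow> (nat \<Rightarrow> real^2) \<Rightarrow> bool \<Rightarrow> bool"
  where "mono_chain s j f b \<longleftrightarrow> side_chain s j f \<and> (\<forall>n\<ge>j. c (f n) = b)"

definition mono_side :: "nat \<Rightarrow> bool"
  where "mono_side k \<longleftrightarrow>
    (\<exists>s\<in>E. \<exists>a b. \<forall>t\<in>{0..1}. c (a + (t * q ^ k) *\<^sub>R dir s) = b)"

lemma no_mono_chain_0: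
  assumes "s \<in> E"
  shows "\<not> mono_chain s 0 f b"
proof
  assume "mono_chain s 0 f b"
  then have "isometric_copy N (geometric_progression q) (range f)" "c constant_on range f"
    using isometric_copy_side_chain[OF assms] by (auto simp: mono_chain_def constant_on_def)
  then show False
    using no_copy by (auto simp: has_monochromatic_copy_def)
qed

lemma mono_sideI_forward:
  assumes "s \<in> E" "\<forall>u\<in>closed_segment (fst s) (snd s). c (p + q ^ n *\<^sub>R u) = b"
  shows "mono_side n"
  unfolding mono_side_def
proof (intro bexI[OF _ assms(1)] exI ballI)
  fix t :: real assume "t \<in> {0..1}"
  then have "(1 - t) *\<^sub>R fst s + t *\<^sub>R snd s \<in> closed_segment (fst s) (snd s)"
    by (auto simp: in_segment)
  from bspec[OF assms(2) this]
  show "c (p + q ^ n *\<^sub>R fst s + (t * q ^ n) *\<^sub>R dir s) = b"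
    by (simp add: dir_def algebra_simps)
qed

lemma backward_segment:
  assumes "\<forall>u\<in>closed_segment (fst s) (snd s). c (p - q ^ n *\<^sub>R u) = b" "t \<in> {0..1}"
  shows "c (p - q ^ n *\<^sub>R snd s + (t * q ^ n) *\<^sub>R dir s) = b"
proof -
  have "t *\<^sub>R fst s + (1 - t) *\<^sub>R snd s \<in> closed_segment (fst s) (snd s)"
    using assms(2) unfolding in_segment by (intro exI[of _ "1 - t"]) auto
  from bspec[OF assms(1) this] show ?thesis
    by (simp add: dir_def algebra_simps)
qed

text \<open>Otherwise every point has, at every scale, a successor with the colour of the origin,
  and dependent choice yields a monochromatic chain from index 0.\<close>

lemma ex_mono_side:
  assumes s: "s \<in> E"
  shows "\<exists>k. mono_side k"
proof (rule ccontr)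
  assume "\<nexists>k. mono_side k"
  then have ext: "\<exists>u\<in>closed_segment (fst s) (snd s). c (p + q ^ n *\<^sub>R u) = c p0" for p n p0
    using mono_sideI_forward[OF s, of p n "\<not> c p0"] by blast
  have "\<exists>f. \<forall>n. c (f n) = c 0 \<and>
      (\<exists>u\<in>closed_segment (fst s) (snd s). f (Suc n) = f n + q ^ n *\<^sub>R u)"
  proof (rule dependent_nat_choice)
    fix p n
    show "\<exists>y. c y = c 0 \<and> (\<exists>u\<in>closed_segment (fst s) (snd s). y = p + q ^ n *\<^sub>R u)"
      using ext[of p n 0] by blast
  qed auto
  then obtain f where "mono_chain s 0 f (c 0)"
    by (auto simp: mono_chain_def side_chain_def)
  then show False
    using no_mono_chain_0[OF s] by blast
qed

lemma mono_chain_extend: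
  assumes f: "mono_chain s (Suc j) f b"
    and u: "u \<in> closed_segment (fst s) (snd s)" "c (f (Suc j) - q ^ j *\<^sub>R u) = b"
  shows "mono_chain s j (f(j := f (Suc j) - q ^ j *\<^sub>R u)) b"
  unfolding mono_chain_def side_chain_def
proof (intro conjI allI impI)
  fix n assume "j \<le> n"
  then consider "n = j" | "Suc j \<le> n" by linarith
  then show "c ((f(j := f (Suc j) - q ^ j *\<^sub>R u)) n) = b"
    "\<exists>u'\<in>closed_segment (fst s) (snd s). (f(j := f (Suc j) - q ^ j *\<^sub>R u)) (Suc n) =
       (f(j := f (Suc j) - q ^ j *\<^sub>R u)) n + q ^ n *\<^sub>R u'"
    using f u by (cases; auto simp: mono_chain_def side_chain_def)+
qed

text \<open>Given a chain from \<open>Suc k\<close>, no predecessor of its first point shares its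
  colour, as that would give a chain from \<open>k\<close>. So all predecessors have the other
  colour, and they form a translate of \<open>q ^ k\<close> times the side.\<close>

lemma no_mono_chain:
  assumes s: "s \<in> E" and "\<forall>i<k. \<not> mono_side i"
  shows "\<not> mono_chain s k f b"
  using assms(2)
proof (induction k arbitrary: f)
  case 0
  show ?case by (rule no_mono_chain_0[OF s])
next
  case (Suc k)
  show ?case
  proof
    assume f: "mono_chain s (Suc k) f b"
    have "\<not> mono_chain s k g b" for g
      using Suc by simp
    then have "\<forall>u\<in>closed_segment (fst s) (snd s). c (f (Suc k) - q ^ k *\<^sub>R u) = (\<not> b)"
      using mono_chain_extend[OF f] by blast
    then have "mono_side k"
      unfolding mono_side_def using backward_segment[of s] by (intro bexI[OF _ s] exI ballI)
    then show False
      using Suc.prems by simp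
  qed
qed

text \<open>How far the straight tail starting at scale \<open>q\<^bsup>k+1\<^esup>\<close> can slide inside \<open>q\<^sup>k\<close> times the
  side \<open>s\<close>, measured in multiples of \<open>dir s\<close>.\<close>

definition slack :: "nat \<Rightarrow> (real^2) \<times> (real^2) \<Rightarrow> real"
  where "slack k s = q ^ k * (1 - q / (1 - q) / N (dir s))"

lemma slack_pos:
  assumes "s \<in> E"
  shows "0 < slack k s"
proof -
  have "q / (1 - q) / N (dir s) < 1"
    using dir_long[OF assms] dir_pos[OF assms] by (simp only: pos_divide_less_eq mult_1)
  then show ?thesis
    using q by (simp only: slack_def zero_less_mult_iff) simp
qed

text \<open>Each round trades the full segment along \<open>F n\<close> for a slide by
  \<open>slack k (F n)\<close>, gains a full segment along \<open>F (Suc n)\<close> and flips the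
  colour. The slack does not depend on \<open>n\<close>, so recurring directions accumulate
  length.\<close>

lemma growing_zonotope:
  assumes s: "s \<in> E" and k: "\<forall>i<k. \<not> mono_side i"
    and start: "\<forall>t\<in>{0..1}. c (a0 + (t * q ^ k) *\<^sub>R dir s) = b0"
  defines "F \<equiv> \<lambda>j. (next_side ^^ j) s"
  shows "\<exists>a b. \<forall>t\<in>{0..1}. \<forall>r. (\<forall>j<n. r j \<in> {0..1}) \<longrightarrow>
    c (a + (t * q ^ k) *\<^sub>R dir (F n) + (\<Sum>j<n. (r j * slack k (F j)) *\<^sub>R dir (F j))) = b"
proof (induction n)
  case 0
  then show ?case
    using start by (auto simp: F_def)
next
  case (Suc n)
  have F: "F j \<in> E" for j
    by (induction j) (auto simp: F_def s next_side)
  have FSuc: "F (Suc n) = next_side (F n)"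
    by (simp add: F_def)
  obtain a b where "\<forall>t\<in>{0..1}. \<forall>r. (\<forall>j<n. r j \<in> {0..1}) \<longrightarrow>
    c (a + (t * q ^ k) *\<^sub>R dir (F n) + (\<Sum>j<n. (r j * slack k (F j)) *\<^sub>R dir (F j))) = b"
    using Suc by (elim exE)
  note ab = mp[OF spec[OF bspec[OF this]]]
  let ?L = "N (dir (F n))"
  have L: "0 < ?L"
    by (rule dir_pos[OF F])
  have "c (a - q ^ k *\<^sub>R snd (F (Suc n)) + (t * q ^ k) *\<^sub>R dir (F (Suc n)) +
      (\<Sum>j<Suc n. (r j * slack k (F j)) *\<^sub>R dir (F j))) = (\<not> b)"
    if t: "t \<in> {0..1}" and r: "\<forall>j<Suc n. r j \<in> {0..1}" for t r
  proof -
    \<comment> \<open>\<open>y\<close> is the first point of a straight tail parallel to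
      \<open>F n\<close>, slid by \<open>r n\<close>. The new monochromatic set consists of the
      possible predecessors of such points \<open>y\<close>.\<close>
    define y where "y = a + (\<Sum>j<Suc n. (r j * slack k (F j)) *\<^sub>R dir (F j))"
    define f where "f = (\<lambda>m. y + (\<Sum>i=Suc k..<m. q ^ i) *\<^sub>R unit_dir (F n))"
    have "c (f m) = b" if "Suc k \<le> m" for m
    proof -
      \<comment> \<open>The position of \<open>f m\<close> on the full segment along
        \<open>F n\<close>: the slide plus the distance travelled. The slack is what remains of
        \<open>q ^ k\<close> after the whole tail, hence \<open>t'\<close> is at most 1.\<close>
      define t' where "t' = (r n * slack k (F n) + (\<Sum>i=Suc k..<m. q ^ i) / ?L) / q ^ k"
      have rn: "0 \<le> r n" "r n \<le> 1"
        using r by auto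
      have "r n * slack k (F n) \<le> slack k (F n)"
        using rn slack_pos[OF F, of k n] by (simp add: mult_left_le_one_le)
      moreover have "(\<Sum>i=Suc k..<m. q ^ i) / ?L \<le> q ^ Suc k / (1 - q) / ?L"
        using L by (intro divide_right_mono geometric_sum_tail(2) q that) simp
      ultimately have "r n * slack k (F n) + (\<Sum>i=Suc k..<m. q ^ i) / ?L \<le> q ^ k"
        by (simp add: slack_def algebra_simps)
      moreover have "0 \<le> r n * slack k (F n)" "0 \<le> (\<Sum>i=Suc k..<m. q ^ i) / ?L"
        using rn slack_pos[OF F, of k n] L q by (auto intro!: divide_nonneg_pos sum_nonneg)
      ultimately have t': "t' \<in> {0..1}"
        using q by (simp add: t'_def)
      have "f m = a + (t' * q ^ k) *\<^sub>R dir (F n) + (\<Sum>j<n. (r j * slack k (F j)) *\<^sub>R dir (F j))"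
      proof -
        have "t' * q ^ k = r n * slack k (F n) + (\<Sum>i=Suc k..<m. q ^ i) / ?L"
          using q by (simp add: t'_def)
        then show ?thesis
          by (simp only: f_def y_def unit_dir_def) (simp add: algebra_simps divide_inverse)
      qed
      then show ?thesis
        using ab[OF t'] r by simp
    qed
    then have f: "mono_chain (F (Suc n)) (Suc k) f b"
      using side_chain_straight[OF F] by (simp add: mono_chain_def f_def FSuc)
    have fy: "f (Suc k) = y"
      by (simp add: f_def)
    \<comment> \<open>A predecessor of colour \<open>b\<close> would extend the tail to a chain from
      \<open>k\<close>, which the absence of smaller monochromatic sides excludes.\<close>
    have "\<forall>u\<in>closed_segment (fst (F (Suc n))) (snd (F (Suc n))). c (y - q ^ k *\<^sub>R u) = (\<not> b)"
      using mono_chain_extend[OF f] no_mono_chain[OF F k] fy by metis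
    then have "c (y - q ^ k *\<^sub>R snd (F (Suc n)) + (t * q ^ k) *\<^sub>R dir (F (Suc n))) = (\<not> b)"
      using t by (rule backward_segment)
    moreover have "a - q ^ k *\<^sub>R snd (F (Suc n)) + (t * q ^ k) *\<^sub>R dir (F (Suc n)) +
        (\<Sum>j<Suc n. (r j * slack k (F j)) *\<^sub>R dir (F j)) =
        y - q ^ k *\<^sub>R snd (F (Suc n)) + (t * q ^ k) *\<^sub>R dir (F (Suc n))"
      by (simp only: y_def diff_conv_add_uminus add_ac)
    ultimately show ?thesis
      by (simp only:)
  qed
  then show ?case
    by (intro exI ballI allI impI)
qed

text \<open>A straight copy along \<open>unit_dir s\<close> has length at most
  \<open>1 / (1 - q)\<close>; dividing by \<open>N (dir s)\<close> measures this in multiples of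
  \<open>dir s\<close>. A segment of that length contains the whole copy.\<close>

lemma no_long_mono_segment:
  assumes s: "s \<in> E" and R: "1 / (1 - q) / N (dir s) \<le> R"
    and c: "\<And>t. t \<in> {0..1} \<Longrightarrow> c (a + (t * R) *\<^sub>R dir s) = b"
  shows False
proof -
  define f where "f = (\<lambda>m. a + (\<Sum>i=0..<m. q ^ i) *\<^sub>R unit_dir s)"
  have L: "0 < N (dir s)"
    by (rule dir_pos[OF s])
  have R0: "0 < R"
    using R L q by (smt (verit) divide_pos_pos)
  have "c (f m) = b" for m
  proof -
    define t where "t = (\<Sum>i=0..<m. q ^ i) / N (dir s) / R"
    have "(\<Sum>i=0..<m. q ^ i) / N (dir s) \<le> 1 / (1 - q) / N (dir s)"
      using geometric_sum_tail(2)[OF q, of 0 m] L by (intro divide_right_mono) auto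
    with R have "(\<Sum>i=0..<m. q ^ i) / N (dir s) \<le> R"
      by linarith
    moreover have "0 \<le> (\<Sum>i=0..<m. q ^ i) / N (dir s)"
      using L q by (auto intro!: divide_nonneg_pos sum_nonneg)
    ultimately have "t \<in> {0..1}"
      unfolding t_def atLeastAtMost_iff using R0
      by (intro conjI) (simp_all only: pos_divide_le_eq mult_1 divide_nonneg_pos)
    moreover have "f m = a + (t * R) *\<^sub>R dir s"
      using R0 by (simp add: f_def t_def unit_dir_def divide_inverse)
    ultimately show ?thesis
      using c by simp
  qed
  then have "mono_chain (next_side s) 0 f b"
    using side_chain_straight[OF s, of 0] by (simp add: mono_chain_def f_def)
  then show False
    using no_mono_chain_0 next_side(1)[OF s] by blast
qed

lemma no_bad_colouring: False
proof -
  obtain e where "e \<in> E"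
    using cones_cover[of "axis 1 1"] by (auto simp: axis_eq_0_iff)
  define k where "k = (LEAST k. mono_side k)"
  have "mono_side k"
    unfolding k_def using ex_mono_side[OF \<open>e \<in> E\<close>] by (rule LeastI_ex)
  moreover have k: "\<forall>i<k. \<not> mono_side i"
    using not_less_Least unfolding k_def by blast
  ultimately obtain s a0 b0 where s: "s \<in> E"
    and start: "\<forall>t\<in>{0..1}. c (a0 + (t * q ^ k) *\<^sub>R dir s) = b0"
    by (auto simp: mono_side_def)
  define F where "F j = (next_side ^^ j) s" for j
  have "F j \<in> E" for j
    by (induction j) (auto simp: F_def s next_side)
  then have "finite (range F)"
    using finite_sides by (meson finite_subset image_subsetI)
  then obtain j0 where inf: "infinite {j. F j = F j0}"
    using pigeonhole_infinite[of UNIV F] by auto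
  define s' where "s' = F j0"
  have s': "s' \<in> E"
    using \<open>F j0 \<in> E\<close> by (simp add: s'_def)
  \<comment> \<open>\<open>M\<close> repetitions of the direction \<open>s'\<close> have a combined
    slack exceeding the length of a full copy.\<close>
  obtain M :: nat where M: "1 / (1 - q) / N (dir s') < M * slack k s'"
    using reals_Archimedean3[OF slack_pos[OF s', of k]] by blast
  obtain T where T: "finite T" "card T = M" "T \<subseteq> {j. F j = s'}"
    using infinite_arbitrarily_large[OF inf] by (auto simp: s'_def)
  obtain n where n: "T \<subseteq> {..<n}"
    using T(1) finite_nat_bounded by blast
  obtain a b where "\<forall>t\<in>{0..1}. \<forall>r. (\<forall>j<n. r j \<in> {0..1}) \<longrightarrow>
    c (a + (t * q ^ k) *\<^sub>R dir (F n) + (\<Sum>j<n. (r j * slack k (F j)) *\<^sub>R dir (F j))) = b"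
    using growing_zonotope[OF s k start, of n] unfolding F_def by (elim exE)
  note ab = mp[OF spec[OF bspec[OF this]]]
  have "c (a + (t * (M * slack k s')) *\<^sub>R dir s') = b" if t: "t \<in> {0..1}" for t
  proof -
    \<comment> \<open>Moving the coordinates in \<open>T\<close> together and freezing all others at
      0, including the full segment along \<open>F n\<close>, cuts a long segment parallel to
      \<open>s'\<close> out of the zonotope.\<close>
    let ?r = "\<lambda>j. if j \<in> T then t else 0"
    have "(\<Sum>j<n. (?r j * slack k (F j)) *\<^sub>R dir (F j)) = (\<Sum>j\<in>T. (t * slack k s') *\<^sub>R dir s')"
      using n T by (intro sum.mono_neutral_cong_right) auto
    also have "\<dots> = (t * (M * slack k s')) *\<^sub>R dir s'"
      by (simp add: T sum_constant_scaleR mult_ac del: sum_constant)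
    finally have "(\<Sum>j<n. (?r j * slack k (F j)) *\<^sub>R dir (F j)) = (t * (M * slack k s')) *\<^sub>R dir s'" .
    moreover have "\<forall>j<n. ?r j \<in> {0..1}"
      using t by simp
    ultimately show ?thesis
      using ab[of 0 ?r] by simp
  qed
  then show False
    using no_long_mono_segment[OF s' less_imp_le[OF M]] by blast
qed

end

section \<open>Faces of the unit disc of a polygonal norm\<close>

lemma aff_dim_unit_disc:
  assumes N: "is_norm N"
  shows "aff_dim (unit_disc N) = 2"
proof -
  have "x \<in> span (unit_disc N)" for x
  proof (cases "x = 0")
    case False
    then have "0 < N x"
      using is_normD(1,2)[OF N, of x] by linarith
    then have "x /\<^sub>R N x \<in> unit_disc N"
      by (simp add: unit_disc_def is_normD(3)[OF N])
    then have "N x *\<^sub>R (x /\<^sub>R N x) \<in> span (unit_disc N)"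
      by (intro span_scale span_base)
    then show ?thesis
      using \<open>0 < N x\<close> by simp
  qed (simp add: span_zero)
  then have "span (unit_disc N) = UNIV"
    by blast
  moreover have "0 \<in> unit_disc N"
    using is_normD(2)[OF N, of 0] by (simp add: unit_disc_def)
  ultimately show ?thesis
    by (simp add: aff_dim_zero hull_inc dim_eq_full[THEN iffD2])
qed

text \<open>If \<open>N x < 1\<close>, the segment from any other point \<open>y\<close> of the disc
  to \<open>x\<close> can be prolonged beyond \<open>x\<close> within the disc. The face property
  then puts \<open>y\<close> into \<open>F\<close>, so \<open>F\<close> is the whole disc.\<close>

lemma proper_face_unit_disc:
  assumes N: "is_norm N" and F: "F face_of unit_disc N" "F \<noteq> unit_disc N" and x: "x \<in> F"
  shows "N x = 1"
proof (rule ccontr)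
  assume "N x \<noteq> 1"
  have "x \<in> unit_disc N"
    using F x face_of_imp_subset by blast
  with \<open>N x \<noteq> 1\<close> have "N x < 1"
    by (simp add: unit_disc_def)
  have "y \<in> F" if y: "y \<in> unit_disc N" for y
  proof (cases "y = x")
    case False
    \<comment> \<open>The largest factor for which the triangle inequality keeps \<open>z\<close> in
      the disc.\<close>
    define e where "e = (1 - N x) / N (x - y)"
    define z where "z = x + e *\<^sub>R (x - y)"
    have pos: "0 < N (x - y)"
      using False is_normD(1,2)[OF N, of "x - y"] by auto
    then have e: "0 < e"
      using \<open>N x < 1\<close> by (simp add: e_def)
    have "N z \<le> N x + e * N (x - y)"
      unfolding z_def using is_normD(3,4)[OF N] e by (metis abs_of_pos)
    then have z: "z \<in> unit_disc N"
      using pos by (simp add: unit_disc_def e_def)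
    have "z - y = (1 + e) *\<^sub>R (x - y)"
      by (simp add: z_def algebra_simps)
    moreover have "(1 - inverse (1 + e)) *\<^sub>R y + inverse (1 + e) *\<^sub>R z =
        y + inverse (1 + e) *\<^sub>R (z - y)"
      by (simp add: algebra_simps)
    ultimately have xy: "x = (1 - inverse (1 + e)) *\<^sub>R y + inverse (1 + e) *\<^sub>R z"
      using e by simp
    have "y \<noteq> z"
      using \<open>z - y = (1 + e) *\<^sub>R (x - y)\<close> e False by auto
    then have "x \<in> open_segment y z"
      using xy e unfolding in_segment
      by (intro conjI exI[of _ "inverse (1 + e)"]) (auto simp: inverse_less_1_iff)
    then show ?thesis
      using F(1) x y z by (auto simp: face_of_def)
  qed (use x in simp)
  then show False
    using F face_of_imp_subset by blast
qed

text \<open>Dividing by \<open>a + b\<close> gives a point of the side, which is a proper face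
  because its dimension is 1 and not 2; so that point has norm 1.\<close>

lemma norm_cone_consecutive_vertices:
  assumes N: "is_norm N" and vw: "consecutive_vertices (unit_disc N) v w" and ab: "0 \<le> a" "0 \<le> b"
  shows "N (a *\<^sub>R v + b *\<^sub>R w) = a + b"
proof (cases "a + b = 0")
  case True
  then show ?thesis
    using ab is_normD(2)[OF N, of 0] by (simp add: add_nonneg_eq_0_iff)
next
  case False
  have edge: "closed_segment v w face_of unit_disc N" "aff_dim (closed_segment v w) = 1"
    using vw by (auto simp: consecutive_vertices_def edge_of_def)
  define x where "x = (1 - b / (a + b)) *\<^sub>R v + (b / (a + b)) *\<^sub>R w"
  have "x \<in> closed_segment v w"
    using ab False unfolding in_segment x_def by (intro exI[of _ "b / (a + b)"]) auto
  then have "N x = 1"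
    using edge aff_dim_unit_disc[OF N] by (intro proper_face_unit_disc[OF N edge(1)]) auto
  moreover have "(a + b) * (1 - b / (a + b)) = a"
    using False by (simp add: right_diff_distrib)
  then have "a *\<^sub>R v + b *\<^sub>R w = (a + b) *\<^sub>R x"
    using False by (simp add: x_def scaleR_add_right)
  ultimately show ?thesis
    using ab by (simp add: is_normD(3)[OF N])
qed

text \<open>A unit vector lies on the relative frontier, hence in a facet. Here a facet is compact,
  convex and one-dimensional, so a segment, and its ends are extreme points of the disc too.\<close>

lemma unit_vector_in_edge:
  assumes N: "polygonal_norm N" and x: "N x = 1"
  obtains v w where "consecutive_vertices (unit_disc N) v w" "x \<in> closed_segment v w"
proof -
  let ?P = "unit_disc N"
  have norm: "is_norm N" and poly: "polytope ?P"
    using N by (auto simp: polygonal_norm_def)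
  have "x \<in> ?P" "0 \<in> ?P"
    using x is_normD(2)[OF norm, of 0] by (auto simp: unit_disc_def)
  \<comment> \<open>A relative interior point could be pushed away from 0 within the disc, to norm
    \<open>e > 1\<close>.\<close>
  have "x \<notin> rel_interior ?P"
  proof
    assume "x \<in> rel_interior ?P"
    then obtain e where "e > 1" "e *\<^sub>R x \<in> ?P"
      using convex_rel_interior_iff[OF polytope_imp_convex[OF poly], of x] \<open>0 \<in> ?P\<close> by fastforce
    then show False
      using x by (simp add: unit_disc_def is_normD(3)[OF norm])
  qed
  then have "x \<in> rel_frontier ?P"
    using \<open>x \<in> ?P\<close> closure_subset by (auto simp: rel_frontier_def)
  then obtain F where F: "F facet_of ?P" "x \<in> F"
    using rel_frontier_of_polyhedron[OF polytope_imp_polyhedron[OF poly]] by auto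
  then have face: "F face_of ?P" and dim: "aff_dim F = 1"
    using aff_dim_unit_disc[OF norm] by (auto simp: facet_of_def)
  have "polytope F"
    using face_of_polytope_polytope[OF poly face] .
  moreover have "collinear F"
    using dim by (simp add: collinear_aff_dim)
  ultimately obtain v w where vw: "F = closed_segment v w"
    using compact_convex_collinear_segment[of F] F(2) polytope_imp_compact polytope_imp_convex by blast
  have "v \<noteq> w"
    using dim vw by auto
  moreover have "v extreme_point_of F" "w extreme_point_of F"
    by (simp_all add: vw extreme_point_of_segment)
  ultimately have "consecutive_vertices ?P v w"
    using extreme_point_of_face[OF face] face dim vw
    by (auto simp: consecutive_vertices_def edge_of_def)
  then show thesis
    using that F(2) vw by blast
qed

section \<open>Finiteness of the sides and the bound on \<open>q\<close>\<close>

lemma finite_consecutive_vertices: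
  assumes "polytope P"
  shows "finite {(v, w). consecutive_vertices P v w}"
proof (rule finite_subset)
  show "{(v, w). consecutive_vertices P v w} \<subseteq> {v. v extreme_point_of P} \<times> {v. v extreme_point_of P}"
    by (auto simp: consecutive_vertices_def)
  show "finite \<dots>"
    using finite_polyhedron_extreme_points[OF polytope_imp_polyhedron[OF assms]] by simp
qed

lemma min_side_length_le:
  assumes "polygonal_norm N" "consecutive_vertices (unit_disc N) v w"
  shows "min_side_length N \<le> N (v - w)"
proof -
  have "{N (v - w) |v w. consecutive_vertices (unit_disc N) v w} =
      (\<lambda>(v, w). N (v - w)) ` {(v, w). consecutive_vertices (unit_disc N) v w}"
    by auto
  then have "finite {N (v - w) |v w. consecutive_vertices (unit_disc N) v w}"
    using finite_consecutive_vertices assms(1) by (simp add: polygonal_norm_def)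
  then show ?thesis
    unfolding min_side_length_def using assms(2) by (intro Min_le) auto
qed

lemma side_system_polygonal_norm:
  assumes N: "polygonal_norm N" and q: "0 < q" "q < min_side_length N / (1 + min_side_length N)"
  shows "side_system N q {(v, w). consecutive_vertices (unit_disc N) v w}"
proof -
  let ?l = "min_side_length N"
  have norm: "is_norm N" and poly: "polytope (unit_disc N)"
    using N by (auto simp: polygonal_norm_def)
  have edge_through: "\<exists>v w. consecutive_vertices (unit_disc N) v w \<and> x /\<^sub>R N x \<in> closed_segment v w"
    if "x \<noteq> 0" for x
  proof -
    have "N (x /\<^sub>R N x) = 1"
      using is_normD(1,2)[OF norm, of x] that by (simp add: is_normD(3)[OF norm])
    then show ?thesis
      using unit_vector_in_edge[OF N] by metis
  qed
  \<comment> \<open>\<open>Min\<close> is informative only on a finite nonempty set, so both are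
    checked. The sign of \<open>?l\<close> then allows multiplying the bound on \<open>q\<close> by
    \<open>1 + ?l\<close>.\<close>
  have "0 \<le> ?l"
  proof -
    let ?S = "{N (v - w) |v w. consecutive_vertices (unit_disc N) v w}"
    have "?S = (\<lambda>(v, w). N (v - w)) ` {(v, w). consecutive_vertices (unit_disc N) v w}"
      by auto
    then have "finite ?S"
      using finite_consecutive_vertices[OF poly] by simp
    moreover have "?S \<noteq> {}"
      using edge_through[of "axis 1 1"] by (auto simp: axis_eq_0_iff)
    ultimately have "?l \<in> ?S"
      unfolding min_side_length_def by (rule Min_in)
    then show ?thesis
      using is_normD(1)[OF norm] by auto
  qed
  then have lt: "q * (1 + ?l) < ?l"
    using q(2) by (simp add: pos_less_divide_eq)
  then have "q * (1 + ?l) < 1 * (1 + ?l)"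
    by simp
  then have "q < 1"
    using \<open>0 \<le> ?l\<close> by (simp only: mult_less_cancel_right)
  moreover have "q < ?l * (1 - q)"
    using lt by (simp add: algebra_simps)
  ultimately have q': "q < 1" "q / (1 - q) < ?l"
    by (simp_all add: pos_divide_less_eq)
  show ?thesis
  proof
    show "is_norm N" "0 < q" "q < 1" "finite {(v, w). consecutive_vertices (unit_disc N) v w}"
      using norm q q' finite_consecutive_vertices[OF poly] by auto
    show "N (a *\<^sub>R v + b *\<^sub>R w) = a + b"
      if "(v, w) \<in> {(v, w). consecutive_vertices (unit_disc N) v w}" "0 \<le> a" "0 \<le> b" for v w a b
      using that norm_cone_consecutive_vertices[OF norm] by simp
    show "q / (1 - q) < N (w - v)"
      if "(v, w) \<in> {(v, w). consecutive_vertices (unit_disc N) v w}" for v w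
      using that min_side_length_le[OF N, of v w] q'(2) is_norm_minus_commute[OF norm, of v w] by simp
    show "\<exists>v w a b. (v, w) \<in> {(v, w). consecutive_vertices (unit_disc N) v w} \<and>
        0 \<le> a \<and> 0 \<le> b \<and> x = a *\<^sub>R v + b *\<^sub>R w" if "x \<noteq> 0" for x
    proof -
      obtain v w t where vw: "consecutive_vertices (unit_disc N) v w"
        and t: "0 \<le> t" "t \<le> 1" "x /\<^sub>R N x = (1 - t) *\<^sub>R v + t *\<^sub>R w"
        using edge_through[OF \<open>x \<noteq> 0\<close>] by (auto simp: in_segment)
      have "0 < N x"
        using is_normD(1,2)[OF norm, of x] that by linarith
      then have "x = N x *\<^sub>R (x /\<^sub>R N x)"
        by simp
      also have "\<dots> = (N x * (1 - t)) *\<^sub>R v + (N x * t) *\<^sub>R w"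
        unfolding t(3) by (simp add: scaleR_add_right)
      finally show ?thesis
        using vw t \<open>0 < N x\<close>
        by (intro exI[of _ v] exI[of _ w] exI[of _ "N x * (1 - t)"] exI[of _ "N x * t"]) auto
    qed
  qed
qed

section \<open>From Boolean colourings to the chromatic number\<close>

lemma chromatic_number_ge_3:
  assumes "\<And>c :: real^2 \<Rightarrow> bool. has_monochromatic_copy N M c"
  shows "chromatic_number N M \<ge> 3"
  unfolding chromatic_number_def
proof (rule Inf_greatest, clarify)
  fix k and c :: "real^2 \<Rightarrow> nat"
  assume c: "range c \<subseteq> {..<k}" "\<not> has_monochromatic_copy N M c"
  have "3 \<le> k"
  proof (rule ccontr)
    assume "\<not> 3 \<le> k"
    then have lt: "c x < 2" for x
      using c(1) by (metis (no_types) rangeI subsetD lessThan_iff less_le_trans not_less_eq_eq numeral_2_eq_2 numeral_3_eq_3)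
    \<comment> \<open>Colours below 2 are determined by whether they are 0, so a copy monochromatic
      for this Boolean colouring is monochromatic for \<open>c\<close>.\<close>
    obtain M' where M': "isometric_copy N M M'" "(\<lambda>x. c x = 0) constant_on M'"
      using assms[of "\<lambda>x. c x = 0"] by (auto simp: has_monochromatic_copy_def)
    then obtain b where b: "\<And>x. x \<in> M' \<Longrightarrow> (c x = 0) = b"
      by (auto simp: constant_on_def)
    have "c x = (if b then 0 else 1)" if "x \<in> M'" for x
      using b[OF that] lt[of x] by auto
    then have "c constant_on M'"
      by (auto simp: constant_on_def)
    then show False
      using c(2) M'(1) by (auto simp: has_monochromatic_copy_def)
  qed
  then show "3 \<le> enat k"
    by (simp add: numeral_eq_enat)
qed

theorem theorem2:
  fixes N :: "real^2 \<Rightarrow> real" and q :: real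
  assumes "polygonal_norm N"
    and "0 < q"
    and "q < min_side_length N / (1 + min_side_length N)"
  shows "chromatic_number N (geometric_progression q) \<ge> 3 \<and>
         (\<forall>c :: real^2 \<Rightarrow> bool. has_monochromatic_copy N (geometric_progression q) c)"
proof -
  interpret side_system N q "{(v, w). consecutive_vertices (unit_disc N) v w}"
    by (rule side_system_polygonal_norm[OF assms])
  have "has_monochromatic_copy N (geometric_progression q) c" for c :: "real^2 \<Rightarrow> bool"
  proof (rule ccontr)
    assume "\<not> ?thesis"
    then interpret bad_colouring N q "{(v, w). consecutive_vertices (unit_disc N) v w}" c
      by unfold_locales
    show False
      by (rule no_bad_colouring)
  qed
  then show ?thesis
    using chromatic_number_ge_3 by blast
qed

end
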